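(* Let $(\mathcal{X},d)$ be a Polish (complete separable metric) space and $\lambda>0$. Then $W^{(\lambda)}$ metrizes weak convergence in $\mathcal{P}(\mathcal{X})$: if $(\mu_k)_{k\in\mathbb{N}}$ is a sequence in $\mathcal{P}(\mathcal{X})$ and $\mu\in\mathcal{P}(\mathcal{X})$, then $(\mu_k)_{k\in\mathbb{N}}$ converges weakly to $\mu$ if and only if $W^{(\lambda)}(\mu_k,\mu)\to 0$.
   Context: $\mathcal{P}(\mathcal{X})$ is the set of all Borel probability measures on $\mathcal{X}$; $\Pi(\mu,\nu)$ is the set of Borel probability measures on $\mathcal{X}\times\mathcal{X}$ with marginals $\mu$ and $\nu$. The robust Wasserstein distance is $W^{(\lambda)}(\mu,\nu):=\inf_{\pi\in\Pi(\mu,\nu)}\int\min\{d(x,y),2\lambda\}\,d\pi(x,y)$. Weak convergence means convergence of integrals of bounded continuous functions. *)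

theory Defs
  imports "HOL-Probability.Probability"
begin

definition borel_prob_measures :: "'a::topological_space measure set" where
  "borel_prob_measures = {M. prob_space M \<and> sets M = sets borel}"

definition couplings ::
    "'a::topological_space measure \<Rightarrow> 'a measure \<Rightarrow> ('a \<times> 'a) measure set" where
  "couplings \<mu> \<nu> = {\<pi> \<in> borel_prob_measures. distr \<pi> borel fst = \<mu> \<and> distr \<pi> borel snd = \<nu>}"

text \<open>
  The infimum is taken in the reals. For Borel probability measures \<open>\<mu>\<close>, \<open>\<nu>\<close> on a second countable
  metric space and \<open>lam \<ge> 0\<close> it is a genuine one: the product measure is a coupling, and the
  integrands are Borel with values in \<open>{0..2 * lam}\<close>, so every integral exists and is nonnegative.
\<close>

definition robust_wasserstein ::
    "real \<Rightarrow> 'a::metric_space measure \<Rightarrow> 'a measure \<Rightarrow> real" where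
  "robust_wasserstein lam \<mu> \<nu> =
     (INF \<pi>\<in>couplings \<mu> \<nu>. \<integral>(x, y). min (dist x y) (2 * lam) \<partial>\<pi>)"

definition converges_weakly ::
    "(nat \<Rightarrow> 'a::topological_space measure) \<Rightarrow> 'a measure \<Rightarrow> bool" where
  "converges_weakly M \<mu> \<longleftrightarrow>
     (\<forall>f :: 'a \<Rightarrow> real. continuous_on UNIV f \<and> bounded (range f) \<longrightarrow>
        (\<lambda>k. \<integral>x. f x \<partial>M k) \<longlonglongrightarrow> (\<integral>x. f x \<partial>\<mu>))"

end

theory Submission
  imports Defs
begin

text \<open>
  Write \<open>d\<^sub>\<lambda>(x, y) = min (dist x y) (2 * lam)\<close> for the truncated cost.

  From weak convergence to transport cost: fix a small \<open>e\<close> and a finite continuous partition of unity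
  \<open>\<phi>\<^sub>0, \<dots>, \<phi>\<^sub>n\<close> whose members other than \<open>\<phi>\<^sub>n\<close> live on sets of diameter below \<open>e\<close>, while
  \<open>\<phi>\<^sub>n\<close> has small \<open>\<mu>\<close>-integral; separability supplies it (\<open>exists_small_partition_of_unity\<close>).
  The masses \<open>a\<^sub>i = \<integral> \<phi>\<^sub>i dM\<^sub>k\<close> converge to \<open>b\<^sub>i = \<integral> \<phi>\<^sub>i d\<mu>\<close>, directly by the definition of weak
  convergence. These are two probability vectors on a finite set, so a coupling matrix \<open>c\<close> of them
  can carry mass at least \<open>min a\<^sub>i b\<^sub>i\<close> on each diagonal entry
  (\<open>exists_diagonal_maximal_matrix\<close>). Spreading \<open>c\<^sub>i\<^sub>j\<close> over the
  product of the normalised measures \<open>\<phi>\<^sub>i M\<^sub>k / a\<^sub>i\<close> and \<open>\<phi>\<^sub>j \<mu> / b\<^sub>j\<close> lifts the matrix to a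
  coupling of \<open>M\<^sub>k\<close> and \<open>\<mu>\<close> (\<open>exists_block_coupling\<close>). Under it the diagonal blocks \<open>i < n\<close> cost at
  most \<open>e\<close> and everything else at most \<open>2 * lam\<close> times the remaining mass, whose bound
  \<open>1 - (\<Sum>i<n. min a\<^sub>i b\<^sub>i)\<close> tends to \<open>\<integral> \<phi>\<^sub>n d\<mu> < e\<close>.
  Continuous cutoffs, rather than indicators of sets, are what lets the definition of weak
  convergence apply to the masses as it stands.

  From transport cost to weak convergence: a bounded continuous \<open>f\<close> need not be uniformly
  continuous, but the set of points near which \<open>f\<close> oscillates by more than \<open>e\<close> at scale
  \<open>1 / n\<close> is open and shrinks to the empty set, so its \<open>\<mu>\<close>-measure tends to 0
  (\<open>measure_oscillation_set_tendsto_0\<close>). Off that set, \<open>f x\<close> and \<open>f y\<close> differ by at most \<open>e\<close> unless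
  \<open>x\<close> and \<open>y\<close> are at distance at least \<open>1 / n\<close>, and then a multiple of \<open>d\<^sub>\<lambda>(x, y)\<close> dominates the
  difference. Integrating this pointwise bound against nearly optimal couplings
  (\<open>integral_diff_le_robust_wasserstein\<close>) yields the convergence of the integrals.
\<close>

section \<open>Couplings given by densities\<close>

text \<open>
  By Tonelli, the inner integrals of the density are the densities of the marginals with respect to
  \<open>P\<close> and \<open>Q\<close>. This gives access to couplings by a formula rather than by gluing measures.
\<close>

lemma density_in_couplings:
  fixes P Q :: "'a::second_countable_topology measure"
  assumes P: "P \<in> borel_prob_measures" and Q: "Q \<in> borel_prob_measures"
    and h[measurable]: "h \<in> borel_measurable (P \<Otimes>\<^sub>M Q)"
    and fst: "AE x in P. (\<integral>\<^sup>+y. h (x, y) \<partial>Q) = 1"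
    and snd: "AE y in Q. (\<integral>\<^sup>+x. h (x, y) \<partial>P) = 1"
  shows "density (P \<Otimes>\<^sub>M Q) h \<in> couplings P Q"
proof -
  interpret P: prob_space P using P by (simp add: borel_prob_measures_def)
  interpret Q: prob_space Q using Q by (simp add: borel_prob_measures_def)
  interpret PQ: pair_sigma_finite P Q ..
  have sP[simp, measurable_cong]: "sets P = sets borel" and sQ[simp, measurable_cong]: "sets Q = sets borel"
    using P Q by (simp_all add: borel_prob_measures_def)
  have [simp]: "space P = UNIV" "space Q = UNIV"
    using sets_eq_imp_space_eq[OF sP] sets_eq_imp_space_eq[OF sQ] by simp_all
  have "sets (P \<Otimes>\<^sub>M Q) = sets (borel \<Otimes>\<^sub>M borel)"
    by (rule sets_pair_measure_cong[OF sP sQ])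
  then have sPQ: "sets (P \<Otimes>\<^sub>M Q) = sets borel"
    by (simp only: borel_prod)
  let ?D = "density (P \<Otimes>\<^sub>M Q) h"
  have 1: "distr ?D borel fst = P"
  proof (rule measure_eqI)
    fix A assume "A \<in> sets (distr ?D borel fst)"
    then have [measurable]: "A \<in> sets borel" by simp
    have "emeasure (distr ?D borel fst) A = (\<integral>\<^sup>+z. h z * indicator (fst -` A) z \<partial>(P \<Otimes>\<^sub>M Q))"
      by (subst emeasure_distr, simp, simp, subst emeasure_density)
         (auto simp: space_pair_measure intro:
           measurable_sets[of fst "P \<Otimes>\<^sub>M Q" borel A, simplified space_pair_measure, simplified])
    also have "\<dots> = (\<integral>\<^sup>+z. h z * indicator A (fst z) \<partial>(P \<Otimes>\<^sub>M Q))"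
      by (intro nn_integral_cong) (auto split: split_indicator)
    also have "\<dots> = (\<integral>\<^sup>+x. (\<integral>\<^sup>+y. h (x, y) * indicator A x \<partial>Q) \<partial>P)"
      by (subst Q.nn_integral_fst[symmetric]) auto
    also have "\<dots> = (\<integral>\<^sup>+x. (\<integral>\<^sup>+y. h (x, y) \<partial>Q) * indicator A x \<partial>P)"
      by (intro nn_integral_cong nn_integral_multc) auto
    also have "\<dots> = (\<integral>\<^sup>+x. indicator A x \<partial>P)"
      using fst by (intro nn_integral_cong_AE) auto
    also have "\<dots> = emeasure P A" by simp
    finally show "emeasure (distr ?D borel fst) A = emeasure P A" .
  qed simp
  have 2: "distr ?D borel snd = Q"
  proof (rule measure_eqI)
    fix A assume "A \<in> sets (distr ?D borel snd)"
    then have [measurable]: "A \<in> sets borel" by simp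
    have "emeasure (distr ?D borel snd) A = (\<integral>\<^sup>+z. h z * indicator (snd -` A) z \<partial>(P \<Otimes>\<^sub>M Q))"
      by (subst emeasure_distr, simp, simp, subst emeasure_density)
         (auto simp: space_pair_measure intro:
           measurable_sets[of snd "P \<Otimes>\<^sub>M Q" borel A, simplified space_pair_measure, simplified])
    also have "\<dots> = (\<integral>\<^sup>+z. h z * indicator A (snd z) \<partial>(P \<Otimes>\<^sub>M Q))"
      by (intro nn_integral_cong) (auto split: split_indicator)
    also have "\<dots> = (\<integral>\<^sup>+y. (\<integral>\<^sup>+x. h (x, y) * indicator A y \<partial>P) \<partial>Q)"
      by (subst PQ.nn_integral_snd[symmetric]) auto
    also have "\<dots> = (\<integral>\<^sup>+y. (\<integral>\<^sup>+x. h (x, y) \<partial>P) * indicator A y \<partial>Q)"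
      by (intro nn_integral_cong nn_integral_multc) auto
    also have "\<dots> = (\<integral>\<^sup>+y. indicator A y \<partial>Q)"
      using snd by (intro nn_integral_cong_AE) auto
    also have "\<dots> = emeasure Q A" by simp
    finally show "emeasure (distr ?D borel snd) A = emeasure Q A" .
  qed simp
  have "emeasure ?D (space ?D) = emeasure (distr ?D borel fst) UNIV"
    by (subst emeasure_distr) (auto simp: sPQ space_pair_measure)
  then have "prob_space ?D"
    using P.emeasure_space_1 by (intro prob_spaceI) (simp add: 1)
  then show ?thesis
    unfolding couplings_def borel_prob_measures_def
    using 1 2 sPQ by (simp del: sP sQ)
qed

text \<open>
  A coupling matrix of the two mass vectors \<open>\<integral> \<phi>\<^sub>i dP\<close> and \<open>\<integral> \<phi>\<^sub>j dQ\<close> lifts to a coupling of \<open>P\<close> and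
  \<open>Q\<close>: entry \<open>c i j\<close> is spread over the supports of \<open>\<phi>\<^sub>i\<close> and \<open>\<phi>\<^sub>j\<close> as an independent product. Hence
  a cost bounded blockwise by \<open>K\<close> integrates to at most the discrete cost of \<open>c\<close>.
\<close>

lemma exists_block_coupling:
  fixes P Q :: "'a::second_countable_topology measure" and \<phi> :: "'i \<Rightarrow> 'a \<Rightarrow> real"
  assumes P: "P \<in> borel_prob_measures" and Q: "Q \<in> borel_prob_measures"
    and I: "finite I"
    and meas: "\<And>i. i \<in> I \<Longrightarrow> \<phi> i \<in> borel_measurable borel"
    and nonneg: "\<And>i x. i \<in> I \<Longrightarrow> 0 \<le> \<phi> i x"
    and unity: "\<And>x. (\<Sum>i\<in>I. \<phi> i x) = 1"
    and c: "\<And>i j. i \<in> I \<Longrightarrow> j \<in> I \<Longrightarrow> 0 \<le> c i j"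
    and rows: "\<And>i. i \<in> I \<Longrightarrow> (\<Sum>j\<in>I. c i j) = (\<integral>x. \<phi> i x \<partial>P)"
    and cols: "\<And>j. j \<in> I \<Longrightarrow> (\<Sum>i\<in>I. c i j) = (\<integral>x. \<phi> j x \<partial>Q)"
    and g: "g \<in> borel_measurable borel" "\<And>x y. 0 \<le> g (x, y)" "\<And>x y. g (x, y) \<le> B"
    and K: "\<And>i j x y. i \<in> I \<Longrightarrow> j \<in> I \<Longrightarrow> \<phi> i x > 0 \<Longrightarrow> \<phi> j y > 0 \<Longrightarrow> g (x, y) \<le> K i j"
  shows "\<exists>\<pi>\<in>couplings P Q. (\<integral>z. g z \<partial>\<pi>) \<le> (\<Sum>i\<in>I. \<Sum>j\<in>I. c i j * K i j)"
proof -
  interpret P: prob_space P using P by (simp add: borel_prob_measures_def)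
  interpret Q: prob_space Q using Q by (simp add: borel_prob_measures_def)
  interpret PQ: pair_prob_space P Q ..
  have sP[simp, measurable_cong]: "sets P = sets borel" and sQ[simp, measurable_cong]: "sets Q = sets borel"
    using P Q by (simp_all add: borel_prob_measures_def)
  have [simp]: "space P = UNIV" "space Q = UNIV"
    using sets_eq_imp_space_eq[OF sP] sets_eq_imp_space_eq[OF sQ] by simp_all
  have "sets (P \<Otimes>\<^sub>M Q) = sets (borel \<Otimes>\<^sub>M borel)"
    by (rule sets_pair_measure_cong[OF sP sQ])
  then have sPQ: "sets (P \<Otimes>\<^sub>M Q) = sets borel"
    by (simp only: borel_prod)
  define a where "a i = (\<integral>x. \<phi> i x \<partial>P)" for i
  define b where "b i = (\<integral>x. \<phi> i x \<partial>Q)" for i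
  define w where "w i j = c i j / (a i * b j)" for i j
  define h where "h x y = (\<Sum>i\<in>I. \<Sum>j\<in>I. w i j * (\<phi> i x * \<phi> j y))" for x y
  note [measurable] = meas
  have le1: "\<phi> i x \<le> 1" if "i \<in> I" for i x
    using member_le_sum[of i I "\<lambda>i. \<phi> i x"] that nonneg I by (auto simp: unity)
  have iP: "integrable P (\<phi> i)" if "i \<in> I" for i
    using le1[OF that] nonneg[OF that] meas[OF that] by (intro P.integrable_const_bound[where B = 1]) auto
  have iQ: "integrable Q (\<phi> i)" if "i \<in> I" for i
    using le1[OF that] nonneg[OF that] meas[OF that] by (intro Q.integrable_const_bound[where B = 1]) auto
  have a0: "0 \<le> a i" if "i \<in> I" for i
    unfolding a_def using nonneg[OF that] by simp
  have b0: "0 \<le> b i" if "i \<in> I" for i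
    unfolding b_def using nonneg[OF that] by simp
  \<comment> \<open>A block of mass zero carries no entry of \<open>c\<close>, so the convention \<open>x / 0 = 0\<close> in \<open>w\<close> loses no mass.\<close>
  have ca: "c i j = 0" if "i \<in> I" "j \<in> I" "a i = 0" for i j
    using that rows[OF that(1)] sum_nonneg_eq_0_iff[OF I, of "c i"] c by (auto simp: a_def)
  have cb: "c i j = 0" if "i \<in> I" "j \<in> I" "b j = 0" for i j
    using that cols[OF that(2)] sum_nonneg_eq_0_iff[OF I, of "\<lambda>i. c i j"] c by (auto simp: b_def)
  have w0: "0 \<le> w i j" if "i \<in> I" "j \<in> I" for i j
    unfolding w_def using that a0 b0 c by simp
  have h0: "0 \<le> h x y" for x y
    unfolding h_def using w0 nonneg by (intro sum_nonneg mult_nonneg_nonneg) auto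
  \<comment> \<open>The right-hand side is 1 or, for a block of mass zero, 0; then \<open>\<phi> i\<close> vanishes almost everywhere.\<close>
  have sum_b: "(\<Sum>j\<in>I. w i j * b j) = a i / a i" if "i \<in> I" for i
  proof -
    have "(\<Sum>j\<in>I. w i j * b j) = (\<Sum>j\<in>I. c i j / a i)"
      using that cb by (intro sum.cong) (auto simp: w_def)
    then show ?thesis
      using rows[OF that] by (simp add: a_def sum_divide_distrib[symmetric])
  qed
  have sum_a: "(\<Sum>i\<in>I. w i j * a i) = b j / b j" if "j \<in> I" for j
  proof -
    have "(\<Sum>i\<in>I. w i j * a i) = (\<Sum>i\<in>I. c i j / b j)"
      using that ca by (intro sum.cong) (auto simp: w_def)
    then show ?thesis
      using cols[OF that] by (simp add: b_def sum_divide_distrib[symmetric])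
  qed
  have h_meas[measurable]: "(\<lambda>z. h (fst z) (snd z)) \<in> borel_measurable (P \<Otimes>\<^sub>M Q)"
    unfolding h_def by measurable
  let ?h = "\<lambda>z. ennreal (h (fst z) (snd z))"
  have "AE x in P. \<forall>i\<in>I. a i = 0 \<longrightarrow> \<phi> i x = 0"
  proof (intro AE_finite_allI I AE_impI)
    show "AE x in P. \<phi> i x = 0" if "i \<in> I" "a i = 0" for i
      using that iP[OF that(1)] nonneg integral_nonneg_eq_0_iff_AE[of P "\<phi> i"] by (simp add: a_def)
  qed
  then have 1: "AE x in P. (\<integral>\<^sup>+y. ?h (x, y) \<partial>Q) = 1"
  proof eventually_elim
    fix x assume x: "\<forall>i\<in>I. a i = 0 \<longrightarrow> \<phi> i x = 0"
    have "(\<integral>\<^sup>+y. ?h (x, y) \<partial>Q) = ennreal (\<integral>y. h x y \<partial>Q)"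
      using h0 iQ by (simp, intro nn_integral_eq_integral) (auto simp: h_def intro!: Bochner_Integration.integrable_sum integrable_mult_right)
    also have "(\<integral>y. h x y \<partial>Q) = (\<Sum>i\<in>I. \<phi> i x * (\<Sum>j\<in>I. w i j * b j))"
      unfolding h_def using iQ
      by (simp add: Bochner_Integration.integral_sum Bochner_Integration.integrable_sum integrable_mult_right sum_distrib_left b_def mult.left_commute mult.assoc)
    also have "\<dots> = (\<Sum>i\<in>I. \<phi> i x)"
      using x by (intro sum.cong) (auto simp: sum_b)
    finally show "(\<integral>\<^sup>+y. ?h (x, y) \<partial>Q) = 1" by (simp add: unity)
  qed
  have "AE y in Q. \<forall>j\<in>I. b j = 0 \<longrightarrow> \<phi> j y = 0"
  proof (intro AE_finite_allI I AE_impI)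
    show "AE y in Q. \<phi> j y = 0" if "j \<in> I" "b j = 0" for j
      using that iQ[OF that(1)] nonneg integral_nonneg_eq_0_iff_AE[of Q "\<phi> j"] by (simp add: b_def)
  qed
  then have 2: "AE y in Q. (\<integral>\<^sup>+x. ?h (x, y) \<partial>P) = 1"
  proof eventually_elim
    fix y assume y: "\<forall>j\<in>I. b j = 0 \<longrightarrow> \<phi> j y = 0"
    have "(\<integral>\<^sup>+x. ?h (x, y) \<partial>P) = ennreal (\<integral>x. h x y \<partial>P)"
      using h0 iP by (simp, intro nn_integral_eq_integral) (auto simp: h_def intro!: Bochner_Integration.integrable_sum integrable_mult_right integrable_mult_left)
    also have "(\<integral>x. h x y \<partial>P) = (\<Sum>i\<in>I. \<Sum>j\<in>I. \<phi> j y * (w i j * a i))"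
      unfolding h_def using iP
      by (simp add: Bochner_Integration.integral_sum Bochner_Integration.integrable_sum integrable_mult_right integrable_mult_left a_def mult_ac)
    also have "\<dots> = (\<Sum>j\<in>I. \<phi> j y * (\<Sum>i\<in>I. w i j * a i))"
      by (subst sum.swap) (simp add: sum_distrib_left)
    also have "\<dots> = (\<Sum>j\<in>I. \<phi> j y)"
      using y by (intro sum.cong) (auto simp: sum_a)
    finally show "(\<integral>\<^sup>+x. ?h (x, y) \<partial>P) = 1" by (simp add: unity)
  qed
  have coup: "density (P \<Otimes>\<^sub>M Q) ?h \<in> couplings P Q"
    by (rule density_in_couplings[OF P Q _ 1 2]) measurable
  have gm[measurable]: "g \<in> borel_measurable (P \<Otimes>\<^sub>M Q)"
    using g(1) by (simp add: measurable_cong_sets[OF sPQ refl])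
  have B0: "0 \<le> B" using order_trans[OF g(2) g(3)] .
  have iPQ: "integrable (P \<Otimes>\<^sub>M Q) (\<lambda>z. \<phi> i (fst z) * \<phi> j (snd z))" if "i \<in> I" "j \<in> I" for i j
    using that le1 nonneg
    by (intro PQ.integrable_const_bound[where B = 1]) (auto simp: abs_mult intro!: mult_le_one)
  have iPQ_eq: "(\<integral>z. \<phi> i (fst z) * \<phi> j (snd z) \<partial>(P \<Otimes>\<^sub>M Q)) = a i * b j" if "i \<in> I" "j \<in> I" for i j
    using iPQ[OF that] by (subst PQ.integral_fst'[symmetric]) (auto simp: a_def b_def)
  let ?T = "\<lambda>i j z. w i j * (\<phi> i (fst z) * \<phi> j (snd z)) * K i j"
  have pt: "h (fst z) (snd z) * g z \<le> (\<Sum>i\<in>I. \<Sum>j\<in>I. ?T i j z)" for z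
  proof -
    have "w i j * (\<phi> i (fst z) * \<phi> j (snd z)) * g z \<le> ?T i j z" if "i \<in> I" "j \<in> I" for i j
    proof (cases "\<phi> i (fst z) = 0 \<or> \<phi> j (snd z) = 0")
      case False
      then have "g (fst z, snd z) \<le> K i j"
        using that nonneg[of i "fst z"] nonneg[of j "snd z"] by (intro K) auto
      then show ?thesis
        using that w0[OF that] nonneg by (intro mult_left_mono) auto
    qed auto
    then show ?thesis
      unfolding h_def sum_distrib_right by (intro sum_mono)
  qed
  have int_hg: "integrable (P \<Otimes>\<^sub>M Q) (\<lambda>z. h (fst z) (snd z) * g z)"
  proof (rule Bochner_Integration.integrable_bound)
    show "integrable (P \<Otimes>\<^sub>M Q) (\<lambda>z. h (fst z) (snd z) * B)"
      unfolding h_def using iPQ by (intro integrable_mult_left Bochner_Integration.integrable_sum integrable_mult_right)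
    show "AE z in P \<Otimes>\<^sub>M Q. norm (h (fst z) (snd z) * g z) \<le> norm (h (fst z) (snd z) * B)"
      using h0 g B0 by (intro AE_I2) (auto simp: abs_mult intro!: mult_left_mono)
  qed measurable
  have "(\<integral>z. g z \<partial>density (P \<Otimes>\<^sub>M Q) ?h) = (\<integral>z. h (fst z) (snd z) * g z \<partial>(P \<Otimes>\<^sub>M Q))"
    by (subst integral_density) (auto simp: h0)
  also have "\<dots> \<le> (\<integral>z. (\<Sum>i\<in>I. \<Sum>j\<in>I. ?T i j z) \<partial>(P \<Otimes>\<^sub>M Q))"
    using iPQ by (intro integral_mono int_hg pt Bochner_Integration.integrable_sum integrable_mult_right integrable_mult_left)
  also have "\<dots> = (\<Sum>i\<in>I. \<Sum>j\<in>I. w i j * (a i * b j) * K i j)"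
    using iPQ by (simp add: Bochner_Integration.integral_sum Bochner_Integration.integrable_sum integrable_mult_right integrable_mult_left iPQ_eq)
  also have "\<dots> = (\<Sum>i\<in>I. \<Sum>j\<in>I. c i j * K i j)"
  proof (intro sum.cong refl)
    show "w i j * (a i * b j) * K i j = c i j * K i j" if "i \<in> I" "j \<in> I" for i j
      using ca[OF that] cb[OF that] by (auto simp: w_def)
  qed
  finally show ?thesis using coup by blast
qed

section \<open>Coupling two probability vectors\<close>

text \<open>
  The maximal coupling of discrete distributions: keep the common part \<open>m = min a b\<close> in place and
  couple the two excesses \<open>a - m\<close> and \<open>b - m\<close>, which have the same total \<open>r\<close>, independently.
\<close>

lemma exists_diagonal_maximal_matrix:
  fixes a b :: "'i \<Rightarrow> real"
  assumes I: "finite I" and a0: "\<And>i. i \<in> I \<Longrightarrow> 0 \<le> a i" and b0: "\<And>i. i \<in> I \<Longrightarrow> 0 \<le> b i"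
    and a1: "sum a I = 1" and b1: "sum b I = 1"
  obtains c :: "'i \<Rightarrow> 'i \<Rightarrow> real" where "\<And>i j. i \<in> I \<Longrightarrow> j \<in> I \<Longrightarrow> 0 \<le> c i j"
    "\<And>i. i \<in> I \<Longrightarrow> (\<Sum>j\<in>I. c i j) = a i" "\<And>j. j \<in> I \<Longrightarrow> (\<Sum>i\<in>I. c i j) = b j"
    "\<And>i. i \<in> I \<Longrightarrow> min (a i) (b i) \<le> c i i"
proof -
  define m where "m i = min (a i) (b i)" for i
  define r where "r = 1 - sum m I"
  have ra: "(\<Sum>i\<in>I. a i - m i) = r" and rb: "(\<Sum>i\<in>I. b i - m i) = r"
    by (simp_all add: sum_subtractf a1 b1 r_def)
  have am: "0 \<le> a i - m i" and bm: "0 \<le> b i - m i" for i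
    by (simp_all add: m_def)
  have r0: "0 \<le> r" using sum_nonneg[of I "\<lambda>i. a i - m i"] am ra by simp
  \<comment> \<open>If \<open>r = 0\<close>, both excesses vanish, so the division by \<open>r\<close> is harmless.\<close>
  have da: "(a i - m i) * r / r = a i - m i" if "i \<in> I" for i
    using sum_nonneg_eq_0_iff[OF I, of "\<lambda>i. a i - m i"] am ra that by auto
  have db: "r * (b i - m i) / r = b i - m i" if "i \<in> I" for i
    using sum_nonneg_eq_0_iff[OF I, of "\<lambda>i. b i - m i"] bm rb that by auto
  let ?c = "\<lambda>i j. (if i = j then m i else 0) + (a i - m i) * (b j - m j) / r"
  show thesis
  proof (rule that[of ?c])
    show "0 \<le> ?c i j" if "i \<in> I" "j \<in> I" for i j
      using that am[of i] bm[of j] r0 a0 b0 by (auto simp: m_def)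
    show "(\<Sum>j\<in>I. ?c i j) = a i" if "i \<in> I" for i
      using that I da[OF that]
      by (simp add: sum.distrib sum_divide_distrib[symmetric] sum_distrib_left[symmetric] rb)
    show "(\<Sum>i\<in>I. ?c i j) = b j" if "j \<in> I" for j
      using that I db[OF that]
      by (simp add: sum.distrib sum_divide_distrib[symmetric] sum_distrib_right[symmetric] ra)
    show "min (a i) (b i) \<le> ?c i i" if "i \<in> I" for i
      using am[of i] bm[of i] r0 by (simp add: m_def)
  qed
qed

section \<open>Partitions of unity with small supports\<close>

text \<open>
  Tent functions \<open>t\<^sub>i\<close> around a dense sequence are made into a partition of unity by letting each take
  its share of what the earlier ones left: \<open>t\<^sub>i\<close> times the remainder \<open>\<Prod>j<i. 1 - t\<^sub>j\<close>. The
  remainder vanishes eventually at every point, so by dominated convergence finitely many steps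
  exhaust all but a small part of the mass; the final remainder is the last member.
\<close>

lemma exists_small_partition_of_unity:
  fixes \<mu> :: "'a::{metric_space, second_countable_topology} measure"
  assumes \<mu>: "\<mu> \<in> borel_prob_measures" and e: "0 < e"
  obtains n and \<phi> :: "nat \<Rightarrow> 'a \<Rightarrow> real" where
    "\<And>i. continuous_on UNIV (\<phi> i)" "\<And>i x. 0 \<le> \<phi> i x" "\<And>x. (\<Sum>i\<le>n. \<phi> i x) = 1"
    "\<And>i x y. i < n \<Longrightarrow> 0 < \<phi> i x \<Longrightarrow> 0 < \<phi> i y \<Longrightarrow> dist x y < e"
    "(\<integral>x. \<phi> n x \<partial>\<mu>) < e"
proof -
  interpret prob_space \<mu> using \<mu> by (simp add: borel_prob_measures_def)
  have [simp, measurable_cong]: "sets \<mu> = sets borel" using \<mu> by (simp add: borel_prob_measures_def)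
  obtain D :: "'a set" where D: "countable D" "\<And>X. open X \<Longrightarrow> X \<noteq> {} \<Longrightarrow> \<exists>d\<in>D. d \<in> X"
    by (rule countable_dense_setE) blast
  have "D \<noteq> {}" using D(2)[of UNIV] by auto
  define p where "p = from_nat_into D"
  have dense: "\<exists>i. dist x (p i) < e / 4" for x
  proof -
    obtain d where "d \<in> D" "d \<in> ball x (e / 4)" using D(2)[of "ball x (e / 4)"] e by auto
    moreover obtain i where "p i = d"
      using from_nat_into_surj[OF D(1) \<open>d \<in> D\<close>] by (auto simp: p_def)
    ultimately show ?thesis by auto
  qed
  \<comment> \<open>Equal to 1 within distance \<open>e / 4\<close> of \<open>p i\<close> and to 0 beyond \<open>e / 2\<close>, so supports have diameter at most \<open>e\<close>.\<close>
  define t where "t i x = max 0 (min 1 (2 - dist x (p i) * 4 / e))" for i x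
  have t: "0 \<le> t i x" "t i x \<le> 1" for i x by (auto simp: t_def)
  define R where "R n x = (\<Prod>i<n. 1 - t i x)" for n x
  have ct: "continuous_on UNIV (t i)" for i
    unfolding t_def by (intro continuous_intros) (use e in auto)
  have cR: "continuous_on UNIV (R n)" for n
    unfolding R_def by (intro continuous_intros ct)
  have R: "0 \<le> R n x" "R n x \<le> 1" for n x
    using t unfolding R_def by (auto intro!: prod_nonneg prod_le_1)
  have Rm[measurable]: "R n \<in> borel_measurable borel" for n
    by (rule borel_measurable_continuous_onI[OF cR])
  have "(\<lambda>n. \<integral>x. R n x \<partial>\<mu>) \<longlonglongrightarrow> (\<integral>x. 0 \<partial>\<mu>)"
  proof (rule integral_dominated_convergence[where w = "\<lambda>_. 1"])
    show "AE x in \<mu>. (\<lambda>n. R n x) \<longlonglongrightarrow> 0"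
    proof (intro AE_I2)
      fix x
      obtain i where i: "dist x (p i) < e / 4" using dense by blast
      then have "t i x = 1" using e by (simp add: t_def field_simps)
      then have "R n x = 0" if "i < n" for n
        using that by (auto simp: R_def)
      then have "\<forall>\<^sub>F n in sequentially. R n x = 0"
        by (auto simp: eventually_sequentially Suc_le_eq intro!: exI[of _ "Suc i"])
      then show "(\<lambda>n. R n x) \<longlonglongrightarrow> 0" by (rule tendsto_eventually)
    qed
  qed (use R in auto)
  then have "\<forall>\<^sub>F n in sequentially. (\<integral>x. R n x \<partial>\<mu>) < e"
    using e by (auto dest: order_tendstoD)
  then obtain n where n: "(\<integral>x. R n x \<partial>\<mu>) < e" by (auto simp: eventually_sequentially)
  define \<phi> where "\<phi> i x = (if i < n then t i x * R i x else R i x)" for i x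
  have tele: "(\<Sum>i<k. t i x * R i x) + R k x = 1" for k x
    by (induction k) (auto simp: R_def algebra_simps)
  show thesis
  proof
    show "continuous_on UNIV (\<phi> i)" for i
      unfolding \<phi>_def by (cases "i < n") (auto intro!: continuous_intros ct cR)
    show "0 \<le> \<phi> i x" for i x using t R by (simp add: \<phi>_def)
    show "(\<Sum>i\<le>n. \<phi> i x) = 1" for x
      using tele[of x n] by (simp add: \<phi>_def lessThan_Suc_atMost[symmetric])
    show "(\<integral>x. \<phi> n x \<partial>\<mu>) < e" using n by (simp add: \<phi>_def)
    fix i x y assume "i < n" "0 < \<phi> i x" "0 < \<phi> i y"
    then have "0 < t i x" "0 < t i y" using t R by (auto simp: \<phi>_def zero_less_mult_iff less_le)
    then have "dist x (p i) < e / 2" "dist y (p i) < e / 2"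
      using e by (auto simp: t_def field_simps less_max_iff_disj)
    then show "dist x y < e" by (rule dist_triangle_half_l)
  qed
qed

section \<open>The infimum defining the robust distance\<close>

text \<open>
  The infimum of an empty set of reals is an unspecified number, so without this fact neither
  nonnegativity of the distance nor the choice of nearly optimal couplings would follow.
  The witness is the product measure, written with density 1.
\<close>

lemma couplings_nonempty:
  fixes P Q :: "'a::second_countable_topology measure"
  assumes "P \<in> borel_prob_measures" "Q \<in> borel_prob_measures"
  shows "couplings P Q \<noteq> {}"
proof -
  have "density (P \<Otimes>\<^sub>M Q) (\<lambda>_. 1) \<in> couplings P Q"
    using assms prob_space.emeasure_space_1
    by (intro density_in_couplings) (auto simp: borel_prob_measures_def)
  then show ?thesis by blast
qed

lemma robust_cost_measurable:
  "(\<lambda>(x, y). min (dist x y) (2 * lam)) \<in> borel_measurable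
     (borel :: ('a::{metric_space, second_countable_topology} \<times> 'a) measure)"
  unfolding split_beta by (intro borel_measurable_continuous_onI continuous_intros)

lemma robust_cost_integral_nonneg:
  assumes "lam > 0"
  shows "0 \<le> (\<integral>(x, y). min (dist x y) (2 * lam) \<partial>\<pi>)"
  using assms by (intro integral_nonneg_AE AE_I2) auto

lemma robust_wasserstein_le:
  assumes "lam > 0" "\<pi> \<in> couplings P Q"
  shows "robust_wasserstein lam P Q \<le> (\<integral>(x, y). min (dist x y) (2 * lam) \<partial>\<pi>)"
  unfolding robust_wasserstein_def
  using assms by (intro cINF_lower bdd_belowI2[where m = 0] robust_cost_integral_nonneg)

lemma robust_wasserstein_nonneg:
  fixes P Q :: "'a::{metric_space, second_countable_topology} measure"
  assumes "lam > 0" "P \<in> borel_prob_measures" "Q \<in> borel_prob_measures"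
  shows "0 \<le> robust_wasserstein lam P Q"
  unfolding robust_wasserstein_def
  using assms by (intro cINF_greatest couplings_nonempty robust_cost_integral_nonneg)

section \<open>Weak convergence makes the transport cost small\<close>

text \<open>
  The two summands of the bound are the cost of the mass kept inside blocks of diameter below \<open>e\<close>
  and the largest possible cost \<open>2 * lam\<close> of the mass, eventually below \<open>e\<close>, that is not.
\<close>

lemma weak_imp_eventually_robust_wasserstein_small:
  fixes M :: "nat \<Rightarrow> 'a::{metric_space, second_countable_topology} measure"
  assumes lam: "lam > 0" and M: "\<And>k. M k \<in> borel_prob_measures" and \<mu>: "\<mu> \<in> borel_prob_measures"
    and conv: "converges_weakly M \<mu>" and e: "0 < e"
  shows "\<forall>\<^sub>F k in sequentially. robust_wasserstein lam (M k) \<mu> \<le> e + 2 * lam * e"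
proof -
  obtain n and \<phi> :: "nat \<Rightarrow> 'a \<Rightarrow> real" where
    cont: "\<And>i. continuous_on UNIV (\<phi> i)" and nonneg: "\<And>i x. 0 \<le> \<phi> i x"
    and unity: "\<And>x. (\<Sum>i\<le>n. \<phi> i x) = 1"
    and small: "\<And>i x y. i < n \<Longrightarrow> 0 < \<phi> i x \<Longrightarrow> 0 < \<phi> i y \<Longrightarrow> dist x y < e"
    and rest: "(\<integral>x. \<phi> n x \<partial>\<mu>) < e"
    using exists_small_partition_of_unity[OF \<mu> e] by metis
  have le1: "\<phi> i x \<le> 1" if "i \<le> n" for i x
    using member_le_sum[of i "{..n}" "\<lambda>i. \<phi> i x"] that nonneg by (auto simp: unity)
  have meas: "\<phi> i \<in> borel_measurable borel" for i
    by (rule borel_measurable_continuous_onI[OF cont])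
  define a where "a k i = (\<integral>x. \<phi> i x \<partial>M k)" for k i
  define b where "b i = (\<integral>x. \<phi> i x \<partial>\<mu>)" for i
  have integrable: "integrable P (\<phi> i)" if P: "P \<in> borel_prob_measures" and i: "i \<le> n" for P i
  proof -
    interpret prob_space P using P by (simp add: borel_prob_measures_def)
    have [measurable_cong]: "sets P = sets borel" using P by (simp add: borel_prob_measures_def)
    show ?thesis
      using nonneg le1[OF i] meas[of i] by (intro integrable_const_bound[where B = 1]) auto
  qed
  have sum1: "(\<Sum>i\<le>n. \<integral>x. \<phi> i x \<partial>P) = 1" if P: "P \<in> borel_prob_measures" for P
  proof -
    interpret prob_space P using P by (simp add: borel_prob_measures_def)
    have "(\<Sum>i\<le>n. \<integral>x. \<phi> i x \<partial>P) = (\<integral>x. (\<Sum>i\<le>n. \<phi> i x) \<partial>P)"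
      using integrable[OF P] by (subst Bochner_Integration.integral_sum) auto
    then show ?thesis by (simp add: unity prob_space)
  qed
  have lim: "(\<lambda>k. a k i) \<longlonglongrightarrow> b i" if "i \<le> n" for i
  proof -
    have "bounded (range (\<phi> i))"
      using nonneg le1[OF that] by (intro boundedI[where B = 1]) auto
    then show ?thesis
      using conv cont by (auto simp: converges_weakly_def a_def b_def)
  qed
  have "(\<lambda>k. 1 - (\<Sum>i<n. min (a k i) (b i))) \<longlonglongrightarrow> 1 - (\<Sum>i<n. min (b i) (b i))"
    by (intro tendsto_intros lim) auto
  moreover have "1 - (\<Sum>i<n. min (b i) (b i)) < e"
    using sum1[OF \<mu>] rest by (simp add: b_def lessThan_Suc_atMost[symmetric])
  ultimately have "\<forall>\<^sub>F k in sequentially. 1 - (\<Sum>i<n. min (a k i) (b i)) < e"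
    by (rule order_tendstoD)
  then show ?thesis
  proof eventually_elim
    fix k assume k: "1 - (\<Sum>i<n. min (a k i) (b i)) < e"
    obtain c where c0: "\<And>i j. i \<in> {..n} \<Longrightarrow> j \<in> {..n} \<Longrightarrow> 0 \<le> c i j"
      and rows: "\<And>i. i \<in> {..n} \<Longrightarrow> (\<Sum>j\<in>{..n}. c i j) = a k i"
      and cols: "\<And>j. j \<in> {..n} \<Longrightarrow> (\<Sum>i\<in>{..n}. c i j) = b j"
      and diag: "\<And>i. i \<in> {..n} \<Longrightarrow> min (a k i) (b i) \<le> c i i"
    proof (rule exists_diagonal_maximal_matrix[of "{..n}" "a k" b])
      show "sum (a k) {..n} = 1" "sum b {..n} = 1"
        using sum1[OF M[of k]] sum1[OF \<mu>] by (simp_all add: a_def b_def)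
    qed (use nonneg in \<open>auto simp: a_def b_def\<close>)
    define K where "K i j = (if i = j \<and> i < n then e else 2 * lam)" for i j
    have "\<exists>\<pi>\<in>couplings (M k) \<mu>. (\<integral>z. (case z of (x, y) \<Rightarrow> min (dist x y) (2 * lam)) \<partial>\<pi>)
        \<le> (\<Sum>i\<in>{..n}. \<Sum>j\<in>{..n}. c i j * K i j)"
    proof (rule exists_block_coupling[where \<phi> = \<phi> and B = "2 * lam"])
      show "(case (x, y) of (x, y) \<Rightarrow> min (dist x y) (2 * lam)) \<le> K i j"
        if "0 < \<phi> i x" "0 < \<phi> j y" for i j x y
        using that small[of i x y] by (auto simp: K_def)
    qed (use M \<mu> meas nonneg unity c0 rows cols lam robust_cost_measurable in \<open>auto simp: a_def b_def\<close>)
    then obtain \<pi> where \<pi>: "\<pi> \<in> couplings (M k) \<mu>" and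
      le: "(\<integral>(x, y). min (dist x y) (2 * lam) \<partial>\<pi>) \<le> (\<Sum>i\<le>n. \<Sum>j\<le>n. c i j * K i j)"
      by auto
    \<comment> \<open>Charge \<open>e\<close> to all of the mass and \<open>2 * lam\<close> to the mass outside the small diagonal blocks.\<close>
    have "(\<Sum>i\<le>n. \<Sum>j\<le>n. c i j * K i j)
        \<le> (\<Sum>i\<le>n. \<Sum>j\<le>n. c i j * e + 2 * lam * (c i j - (if i = j \<and> i < n then c i i else 0)))"
      using c0 e by (intro sum_mono) (auto simp: K_def)
    also have "\<dots> = e * (\<Sum>i\<le>n. \<Sum>j\<le>n. c i j) + 2 * lam * ((\<Sum>i\<le>n. \<Sum>j\<le>n. c i j)
        - (\<Sum>i\<le>n. \<Sum>j\<le>n. if i = j \<and> i < n then c i i else 0))"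
      by (simp add: sum.distrib sum_subtractf sum_distrib_left[symmetric] sum_distrib_right[symmetric])
    also have "(\<Sum>i\<le>n. \<Sum>j\<le>n. c i j) = 1"
      using rows sum1[OF M[of k]] by (simp add: a_def)
    also have "(\<Sum>i\<le>n. \<Sum>j\<le>n. if i = j \<and> i < n then c i i else 0) = (\<Sum>i<n. c i i)"
    proof -
      have "(\<Sum>j\<le>n. if i = j \<and> i < n then c i i else 0) = (if i < n then c i i else 0)" if "i \<le> n" for i
        using that by (cases "i < n") auto
      then show ?thesis by (simp add: lessThan_Suc_atMost[symmetric])
    qed
    also have "e * 1 + 2 * lam * (1 - (\<Sum>i<n. c i i)) \<le> e + 2 * lam * (1 - (\<Sum>i<n. min (a k i) (b i)))"
      using diag lam by (auto intro!: mult_left_mono sum_mono)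
    also have "\<dots> \<le> e + 2 * lam * e"
      using k lam by simp
    finally show "robust_wasserstein lam (M k) \<mu> \<le> e + 2 * lam * e"
      using robust_wasserstein_le[OF lam \<pi>] le by linarith
  qed
qed

section \<open>Small transport cost controls integrals\<close>

text \<open>
  The difference of the integrals is the integral of \<open>f x - f y\<close> under any coupling, and the
  exceptional set \<open>A\<close> concerns \<open>y\<close> only, so its contribution depends on \<open>Q\<close> alone: along a sequence of
  measures \<open>P\<close> it stays the same. Taking the infimum over couplings turns the
  cost term into the distance.
\<close>

lemma integral_diff_le_robust_wasserstein:
  fixes f :: "'a::{metric_space, second_countable_topology} \<Rightarrow> real"
  assumes lam: "lam > 0" and P: "P \<in> borel_prob_measures" and Q: "Q \<in> borel_prob_measures"
    and f[measurable]: "f \<in> borel_measurable borel" and B: "\<And>x. \<bar>f x\<bar> \<le> B"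
    and A[measurable]: "A \<in> sets borel" and C: "0 \<le> C"
    and bound: "\<And>x y. \<bar>f x - f y\<bar> \<le> e + D * indicator A y + C * min (dist x y) (2 * lam)"
  shows "\<bar>(\<integral>x. f x \<partial>P) - (\<integral>x. f x \<partial>Q)\<bar> \<le> e + D * measure Q A + C * robust_wasserstein lam P Q"
proof (rule field_le_epsilon)
  fix d :: real assume "0 < d"
  \<comment> \<open>The slack of the coupling is multiplied by \<open>C\<close> below; dividing by \<open>C + 1\<close> also covers \<open>C = 0\<close>.\<close>
  define d' where "d' = d / (C + 1)"
  have d': "0 < d'" "C * d' \<le> d" using \<open>0 < d\<close> C by (auto simp: d'_def field_simps)
  have "robust_wasserstein lam P Q < robust_wasserstein lam P Q + d'" using d' by simp
  then obtain \<pi> where \<pi>: "\<pi> \<in> couplings P Q"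
    and lt: "(\<integral>(x, y). min (dist x y) (2 * lam) \<partial>\<pi>) < robust_wasserstein lam P Q + d'"
    unfolding robust_wasserstein_def
    using cInf_lessD[of "(\<lambda>\<pi>. \<integral>(x, y). min (dist x y) (2 * lam) \<partial>\<pi>) ` couplings P Q"] couplings_nonempty[OF P Q]
    by fastforce
  have \<pi>b: "\<pi> \<in> borel_prob_measures" and fst: "distr \<pi> borel fst = P" and snd: "distr \<pi> borel snd = Q"
    using \<pi> by (auto simp: couplings_def)
  interpret prob_space \<pi> using \<pi>b by (simp add: borel_prob_measures_def)
  have s[measurable_cong]: "sets \<pi> = sets (borel \<Otimes>\<^sub>M borel)" 
    using \<pi>b by (simp only: borel_prob_measures_def borel_prod mem_Collect_eq)
  have mfst[measurable]: "fst \<in> measurable \<pi> borel" and msnd[measurable]: "snd \<in> measurable \<pi> borel"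
    by measurable
  have i1: "integrable \<pi> (\<lambda>z. f (fst z))" and i2: "integrable \<pi> (\<lambda>z. f (snd z))"
    using B by (intro integrable_const_bound[where B = B], auto)+
  have cm: "(\<lambda>z. min (dist (fst z) (snd z)) (2 * lam)) \<in> borel_measurable \<pi>"
    using robust_cost_measurable[of lam] s by (simp add: split_beta borel_prod cong: measurable_cong_sets)
  have i3: "integrable \<pi> (\<lambda>z. min (dist (fst z) (snd z)) (2 * lam))"
    using lam cm by (intro integrable_const_bound[where B = "2 * lam"]) auto
  have i4: "integrable \<pi> (\<lambda>z. indicator A (snd z) :: real)"
    by (intro integrable_const_bound[where B = 1]) auto
  have "(\<integral>x. f x \<partial>P) - (\<integral>x. f x \<partial>Q) = (\<integral>z. f (fst z) \<partial>\<pi>) - (\<integral>z. f (snd z) \<partial>\<pi>)"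
    by (simp add: fst[symmetric] snd[symmetric] integral_distr)
  also have "\<dots> = (\<integral>z. f (fst z) - f (snd z) \<partial>\<pi>)"
    using i1 i2 by simp
  finally have "\<bar>(\<integral>x. f x \<partial>P) - (\<integral>x. f x \<partial>Q)\<bar> \<le> (\<integral>z. \<bar>f (fst z) - f (snd z)\<bar> \<partial>\<pi>)"
    by simp
  also have "\<dots> \<le> (\<integral>z. e + D * indicator A (snd z) + C * min (dist (fst z) (snd z)) (2 * lam) \<partial>\<pi>)"
    using i1 i2 i3 i4 bound by (intro integral_mono) auto
  also have "\<dots> = e + D * (\<integral>z. indicator A (snd z) \<partial>\<pi>) + C * (\<integral>z. min (dist (fst z) (snd z)) (2 * lam) \<partial>\<pi>)"
    using i3 i4 by (simp add: prob_space)
  also have "(\<integral>z. indicator A (snd z) \<partial>\<pi>) = measure Q A"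
    by (simp add: snd[symmetric] integral_distr[symmetric, OF msnd, of "indicator A :: 'a \<Rightarrow> real"])
  also have "C * (\<integral>z. min (dist (fst z) (snd z)) (2 * lam) \<partial>\<pi>) \<le> C * (robust_wasserstein lam P Q + d')"
    using lt C by (intro mult_left_mono) (auto simp: case_prod_beta')
  also have "\<dots> \<le> C * robust_wasserstein lam P Q + d"
    using d' by (simp add: distrib_left)
  finally show "\<bar>(\<integral>x. f x \<partial>P) - (\<integral>x. f x \<partial>Q)\<bar> \<le> e + D * measure Q A + C * robust_wasserstein lam P Q + d"
    by simp
qed

text \<open>
  Continuity at \<open>y\<close> expels \<open>y\<close> from the oscillation sets once the scale is fine enough, so they
  decrease to the empty set; continuity of \<open>f\<close> also makes them open, hence measurable,
  although they are defined by an uncountable union.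
\<close>

lemma measure_oscillation_set_tendsto_0:
  fixes f :: "'a::metric_space \<Rightarrow> real"
  assumes \<mu>: "\<mu> \<in> borel_prob_measures" and f: "continuous_on UNIV f" and e: "0 < e"
  defines "A \<equiv> \<lambda>n::nat. {y. \<exists>x. dist x y < 1 / Suc n \<and> e < \<bar>f x - f y\<bar>}"
  shows "\<And>n. open (A n)" and "(\<lambda>n. measure \<mu> (A n)) \<longlonglongrightarrow> 0"
proof -
  interpret prob_space \<mu> using \<mu> by (simp add: borel_prob_measures_def)
  show op: "open (A n)" for n
  proof -
    have "A n = (\<Union>x. {y. dist x y < 1 / Suc n} \<inter> {y. e < \<bar>f x - f y\<bar>})"
      by (auto simp: A_def)
    also have "open \<dots>"
      by (intro open_UN ballI open_Int open_Collect_less continuous_intros f)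
    finally show ?thesis .
  qed
  have "(\<lambda>n. measure \<mu> (A n)) \<longlonglongrightarrow> measure \<mu> (\<Inter>n. A n)"
  proof (rule finite_Lim_measure_decseq)
    show "range A \<subseteq> sets \<mu>" using op \<mu> by (auto simp: borel_prob_measures_def)
    show "decseq A"
    proof (rule decseq_SucI)
      fix n
      have "1 / real (Suc (Suc n)) \<le> 1 / real (Suc n)" by (simp add: field_simps)
      then show "A (Suc n) \<le> A n" unfolding A_def by (blast intro: less_le_trans)
    qed
  qed
  also have "(\<Inter>n. A n) = {}"
  proof -
    have False if y: "\<And>n. y \<in> A n" for y
    proof -
      obtain d where d: "0 < d" "\<And>x. dist x y < d \<Longrightarrow> dist (f x) (f y) < e"
        using f e by (metis UNIV_I continuous_on_iff)
      obtain n where "1 / real (Suc n) < d" using d(1) nat_approx_posE by blast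
      moreover obtain x where "dist x y < 1 / Suc n" "e < \<bar>f x - f y\<bar>"
        using y[of n] by (auto simp: A_def)
      ultimately show False using d(2)[of x] by (auto simp: dist_real_def)
    qed
    then show ?thesis by blast
  qed
  finally show "(\<lambda>n. measure \<mu> (A n)) \<longlonglongrightarrow> 0" by simp
qed

text \<open>
  Three error terms, each at most \<open>r / 3\<close>: the tolerated oscillation, the mass of the set where \<open>f\<close>
  oscillates more, and the transport cost. The scale \<open>n\<close>, and with it the constant \<open>C\<close>, has to be fixed from
  \<open>\<mu>\<close> and \<open>f\<close> before the index \<open>k\<close> is taken large.
\<close>

lemma robust_wasserstein_tendsto_0_imp_weak:
  fixes M :: "nat \<Rightarrow> 'a::{metric_space, second_countable_topology} measure"
  assumes lam: "lam > 0" and M: "\<And>k. M k \<in> borel_prob_measures" and \<mu>: "\<mu> \<in> borel_prob_measures"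
    and lim: "(\<lambda>k. robust_wasserstein lam (M k) \<mu>) \<longlonglongrightarrow> 0"
  shows "converges_weakly M \<mu>"
  unfolding converges_weakly_def
proof (intro allI impI, elim conjE)
  fix f :: "'a \<Rightarrow> real" assume f: "continuous_on UNIV f" and "bounded (range f)"
  then obtain B where B: "0 < B" "\<And>x. \<bar>f x\<bar> \<le> B"
    unfolding bounded_pos by auto
  show "(\<lambda>k. \<integral>x. f x \<partial>M k) \<longlonglongrightarrow> (\<integral>x. f x \<partial>\<mu>)"
  proof (rule LIMSEQ_I)
    fix r :: real assume "0 < r"
    define e where "e = r / 3"
    have e: "0 < e" using \<open>0 < r\<close> by (simp add: e_def)
    let ?A = "\<lambda>n::nat. {y. \<exists>x. dist x y < 1 / Suc n \<and> e < \<bar>f x - f y\<bar>}"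
    have "\<forall>\<^sub>F n in sequentially. measure \<mu> (?A n) < e / (2 * B)"
      using measure_oscillation_set_tendsto_0(2)[OF \<mu> f e] e B by (intro order_tendstoD(2)) auto
    then obtain n where n: "measure \<mu> (?A n) < e / (2 * B)" by (auto simp: eventually_sequentially)
    \<comment> \<open>A pair at distance at least \<open>1 / Suc n\<close> has truncated cost at least \<open>s\<close>, so
      \<open>C\<close> times its cost bounds every possible difference of values of \<open>f\<close>.\<close>
    define s where "s = min (1 / Suc n) (2 * lam)"
    have s: "0 < s" using lam by (simp add: s_def)
    define C where "C = 2 * B / s"
    have C: "0 \<le> C" using B s by (simp add: C_def)
    have bound: "\<bar>f x - f y\<bar> \<le> e + 2 * B * indicator (?A n) y + C * min (dist x y) (2 * lam)" for x y
    proof -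
      have ub: "\<bar>f x - f y\<bar> \<le> 2 * B" using B(2)[of x] B(2)[of y] by linarith
      have c0: "0 \<le> C * min (dist x y) (2 * lam)" using C lam by simp
      consider "1 / Suc n \<le> dist x y" | "y \<in> ?A n" | "\<bar>f x - f y\<bar> \<le> e"
        by (metis (mono_tags, lifting) mem_Collect_eq not_le)
      then show ?thesis
      proof cases
        case 1
        then have "s \<le> min (dist x y) (2 * lam)" by (auto simp: s_def)
        then have "C * s \<le> C * min (dist x y) (2 * lam)" using C by (rule mult_left_mono)
        moreover have "C * s = 2 * B" using s by (simp add: C_def)
        moreover have "0 \<le> 2 * B * (indicator (?A n) y :: real)" using B by simp
        ultimately show ?thesis using ub e by linarith
      next
        case 2 then show ?thesis using ub e c0 by simp
      next
        case 3
        moreover have "0 \<le> 2 * B * (indicator (?A n) y :: real)" using B by simp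
        ultimately show ?thesis using c0 by linarith
      qed
    qed
    have "(\<lambda>k. C * robust_wasserstein lam (M k) \<mu>) \<longlonglongrightarrow> C * 0"
      by (intro tendsto_intros lim)
    then have "\<forall>\<^sub>F k in sequentially. C * robust_wasserstein lam (M k) \<mu> < e"
      using e by (intro order_tendstoD(2)) auto
    then obtain N where N: "\<And>k. N \<le> k \<Longrightarrow> C * robust_wasserstein lam (M k) \<mu> < e"
      by (auto simp: eventually_sequentially)
    have "norm ((\<integral>x. f x \<partial>M k) - (\<integral>x. f x \<partial>\<mu>)) < r" if "N \<le> k" for k
    proof -
      have "\<bar>(\<integral>x. f x \<partial>M k) - (\<integral>x. f x \<partial>\<mu>)\<bar>
          \<le> e + 2 * B * measure \<mu> (?A n) + C * robust_wasserstein lam (M k) \<mu>"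
        using measure_oscillation_set_tendsto_0(1)[OF \<mu> f e, of n]
        by (intro integral_diff_le_robust_wasserstein[OF lam M \<mu> _ B(2) _ C bound]
            borel_measurable_continuous_onI[OF f]) auto
      moreover have "2 * B * measure \<mu> (?A n) < e" using n B by (simp add: field_simps)
      ultimately show ?thesis using N[OF that] by (simp add: e_def)
    qed
    then show "\<exists>N. \<forall>k\<ge>N. norm ((\<integral>x. f x \<partial>M k) - (\<integral>x. f x \<partial>\<mu>)) < r" by blast
  qed
qed

section \<open>The robust distance metrizes weak convergence\<close>

theorem theorem3p5:
  fixes lam :: real
    and M :: "nat \<Rightarrow> 'a::polish_space measure"
    and \<mu> :: "'a measure"
  assumes "lam > 0"
    and "\<And>k. M k \<in> borel_prob_measures"
    and "\<mu> \<in> borel_prob_measures"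
  shows "converges_weakly M \<mu> \<longleftrightarrow> (\<lambda>k. robust_wasserstein lam (M k) \<mu>) \<longlonglongrightarrow> 0"
proof
  assume conv: "converges_weakly M \<mu>"
  show "(\<lambda>k. robust_wasserstein lam (M k) \<mu>) \<longlonglongrightarrow> 0"
  proof (rule tendstoI)
    fix r :: real assume "0 < r"
    define e where "e = r / (2 * (1 + 2 * lam))"
    have e: "0 < e" "e + 2 * lam * e < r"
    proof -
      show "0 < e" using \<open>0 < r\<close> assms(1) by (simp add: e_def)
      have "e + 2 * lam * e = e * (1 + 2 * lam)" by (simp add: algebra_simps)
      also have "\<dots> = r / 2" using assms(1) by (simp add: e_def divide_simps)
      finally show "e + 2 * lam * e < r" using \<open>0 < r\<close> by simp
    qed
    show "\<forall>\<^sub>F k in sequentially. dist (robust_wasserstein lam (M k) \<mu>) 0 < r"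
      using weak_imp_eventually_robust_wasserstein_small[OF assms conv e(1)]
    proof eventually_elim
      case (elim k)
      then show ?case using e(2) robust_wasserstein_nonneg[OF assms(1,2,3), of k] by simp
    qed
  qed
next
  assume "(\<lambda>k. robust_wasserstein lam (M k) \<mu>) \<longlonglongrightarrow> 0"
  then show "converges_weakly M \<mu>"
    by (rule robust_wasserstein_tendsto_0_imp_weak[OF assms])
qed

end
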